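(* Let $S$ be a group, let $A=\mathrm{Aut}(S)$, let $Z=Z(S)$, and identify $\mathrm{Inn}(S)\cong S/Z$ with a normal subgroup of $A$ via the conjugation action; for $T\leq S$ let $\overline T=TZ/Z\leq \mathrm{Inn}(S)$. Suppose $S$ has a characteristic subgroup $T$ such that $\overline T$ is a proper subgroup of $\overline S=\mathrm{Inn}(S)$ and $A/\overline T$ is abelian (note $\overline T\trianglelefteq A$ as $T$ is characteristic). Then $S$ is not a chirality group.
   Context: Let $\Delta=\langle r_0,r_1,r_2\mid r_0^2=r_1^2=r_2^2=1\rangle$ and let $\Delta^+$ be its index-$2$ subgroup of even-length words, generated by $\rho=r_1r_2$ and $\lambda=r_2r_0$. An (oriented) hypermap is a triple $(D,R,L)$ with $D$ a finite set and $R,L$ permutations of $D$ generating a group transitive on $D$ (the monodromy group). It is orientably regular if its automorphism group (permutations of $D$ commuting with $R$ and $L$) acts regularly on $D$; orientably regular hypermaps correspond (up to isomorphism) bijectively to normal subgroups $H$ of finite index in $\Delta^+$ (hypermap subgroups), the hypermap being $(\Delta^+/H,\rho,\lambda)$ acting by left multiplication. For $H\trianglelefteq\Delta^+$ put $H^r=r_2Hr_2$. The chirality group of the hypermap is $HH^r/H$ (isomorphic to $H/(H\cap H^r)$). A group $G$ is called a chirality group if $G$ is isomorphic to the chirality group of some orientably regular hypermap. *)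

theory Defs
  imports "HOL-Algebra.Algebra"
begin

section \<open>The group \<open>\<Delta>\<close> and its even subgroup\<close>

datatype gen = R0 | R1 | R2

text \<open>
  \<open>\<Delta>\<close> is presented as a monoid: since every relator is the square of a generator, the generators are
  their own inverses and words in the inverses of the generators are not needed.
\<close>

inductive word_eq :: "gen list \<Rightarrow> gen list \<Rightarrow> bool" where
  word_relator: "word_eq [x, x] []"
| word_refl: "word_eq u u"
| word_sym: "word_eq u v \<Longrightarrow> word_eq v u"
| word_trans: "word_eq u v \<Longrightarrow> word_eq v w \<Longrightarrow> word_eq u w"
| word_append: "word_eq u v \<Longrightarrow> word_eq u' v' \<Longrightarrow> word_eq (u @ u') (v @ v')"

quotient_type delta = "gen list" / word_eq
  by (rule equivpI)
    (auto intro: reflpI sympI transpI word_refl word_sym word_trans)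

lift_definition delta_mult :: "delta \<Rightarrow> delta \<Rightarrow> delta" is "(@)"
  by (rule word_append)

lift_definition delta_one :: delta is "[]" .

lift_definition delta_gen :: "gen \<Rightarrow> delta" is "\<lambda>x. [x]" .

definition Delta :: "delta monoid" where
  "Delta = \<lparr>carrier = UNIV, monoid.mult = delta_mult, one = delta_one\<rparr>"

abbreviation r0 :: delta where "r0 \<equiv> delta_gen R0"
abbreviation r1 :: delta where "r1 \<equiv> delta_gen R1"
abbreviation r2 :: delta where "r2 \<equiv> delta_gen R2"

lemma word_eq_even: "word_eq u v \<Longrightarrow> even (length u) = even (length v)"
  by (induction rule: word_eq.induct) auto

lift_definition even_delta :: "delta \<Rightarrow> bool" is "\<lambda>w. even (length w)"
  by (rule word_eq_even)

definition Delta_plus :: "delta monoid" where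
  "Delta_plus = Delta\<lparr>carrier := {g. even_delta g}\<rparr>"

definition rho :: delta where "rho = r1 \<otimes>\<^bsub>Delta\<^esub> r2"
definition lam :: delta where "lam = r2 \<otimes>\<^bsub>Delta\<^esub> r0"

lemma delta_mult_assoc: "delta_mult (delta_mult a b) c = delta_mult a (delta_mult b c)"
  by transfer (simp add: word_refl)

lemma delta_one_left: "delta_mult delta_one a = a"
  by transfer (simp add: word_refl)

lemma delta_one_right: "delta_mult a delta_one = a"
  by transfer (simp add: word_refl)

lemma delta_gen_square: "delta_mult (delta_gen x) (delta_gen x) = delta_one"
  by transfer (simp add: word_relator)

lemma word_eq_rev: "word_eq u v \<Longrightarrow> word_eq (rev u) (rev v)"
  by (induction rule: word_eq.induct) (auto intro: word_eq.intros)

lemma word_eq_rev_append: "word_eq (rev u @ u) []"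
proof (induction u)
  case Nil
  then show ?case by (simp add: word_refl)
next
  case (Cons x u)
  have "word_eq ((rev u @ [x, x]) @ u) ((rev u @ []) @ u)"
    by (intro word_append word_relator word_refl)
  with Cons show ?case by (auto intro: word_trans)
qed

lemma group_Delta: "group Delta"
proof (rule groupI)
  fix x assume "x \<in> carrier Delta"
  have "\<exists>y. delta_mult y x = delta_one"
    by transfer (use word_eq_rev_append in blast)
  then show "\<exists>y\<in>carrier Delta. y \<otimes>\<^bsub>Delta\<^esub> x = \<one>\<^bsub>Delta\<^esub>"
    by (simp add: Delta_def)
qed (auto simp: Delta_def delta_mult_assoc delta_one_left)

lemma even_delta_mult: "even_delta (delta_mult a b) \<longleftrightarrow> (even_delta a \<longleftrightarrow> even_delta b)"
  by transfer simp

lemma even_delta_one: "even_delta delta_one"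
  by transfer simp

lemma even_delta_gen: "\<not> even_delta (delta_gen x)"
  by transfer simp

lemma subgroup_even: "subgroup {g. even_delta g} Delta"
proof (rule group.subgroupI [OF group_Delta])
  show "{g. even_delta g} \<noteq> {}" using even_delta_one by blast
next
  fix a assume a: "a \<in> {g. even_delta g}"
  have "delta_mult (inv\<^bsub>Delta\<^esub> a) a = delta_one"
    using group.l_inv [OF group_Delta, of a] by (simp add: Delta_def)
  then show "inv\<^bsub>Delta\<^esub> a \<in> {g. even_delta g}"
    using a even_delta_mult [of "inv\<^bsub>Delta\<^esub> a" a] even_delta_one by simp
qed (auto simp: Delta_def even_delta_mult)

lemma group_Delta_plus: "group Delta_plus"
  unfolding Delta_plus_def by (rule group.subgroup_imp_group [OF group_Delta subgroup_even])

lemma Delta_plus_generated: "carrier Delta_plus = generate Delta {rho, lam}" (is "_ = ?N")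
proof
  interpret group Delta by (rule group_Delta)
  have sub: "subgroup ?N Delta"
    by (rule generate_is_subgroup) (simp add: Delta_def)
  have car: "g \<in> carrier Delta" for g by (simp add: Delta_def)
  have one: "\<one>\<^bsub>Delta\<^esub> = delta_one" and mult: "monoid.mult Delta = delta_mult" by (simp_all add: Delta_def)
  have inv_pair: "inv\<^bsub>Delta\<^esub> (delta_gen x \<otimes>\<^bsub>Delta\<^esub> delta_gen y) = delta_gen y \<otimes>\<^bsub>Delta\<^esub> delta_gen x" for x y
    by (rule inv_equality)
      (simp_all add: car, metis delta_gen_square delta_mult_assoc delta_one_right mult one)
  have 12: "r1 \<otimes>\<^bsub>Delta\<^esub> r2 \<in> ?N" and 20: "r2 \<otimes>\<^bsub>Delta\<^esub> r0 \<in> ?N"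
    by (auto simp: rho_def lam_def intro: generate.incl)
  have 21: "r2 \<otimes>\<^bsub>Delta\<^esub> r1 \<in> ?N" and 02: "r0 \<otimes>\<^bsub>Delta\<^esub> r2 \<in> ?N"
    using subgroup.m_inv_closed [OF sub 12] subgroup.m_inv_closed [OF sub 20]
    by (simp_all add: inv_pair)
  have "(r1 \<otimes>\<^bsub>Delta\<^esub> r2) \<otimes>\<^bsub>Delta\<^esub> (r2 \<otimes>\<^bsub>Delta\<^esub> r0) = r1 \<otimes>\<^bsub>Delta\<^esub> r0"
    by (metis delta_gen_square delta_mult_assoc delta_one_left mult)
  with subgroup.m_closed [OF sub 12 20] have 10: "r1 \<otimes>\<^bsub>Delta\<^esub> r0 \<in> ?N" by simp
  from subgroup.m_inv_closed [OF sub this] have 01: "r0 \<otimes>\<^bsub>Delta\<^esub> r1 \<in> ?N"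
    by (simp add: inv_pair)
  have pair: "delta_mult (delta_gen x) (delta_gen y) \<in> ?N" for x y
    using 01 02 10 12 20 21 subgroup.one_closed [OF sub]
    by (cases x; cases y) (auto simp: mult one delta_gen_square)
  have word: "even (length w) \<Longrightarrow> abs_delta w \<in> ?N" for w
  proof (induction w rule: induct_list012)
    case 1
    show ?case using subgroup.one_closed [OF sub] by (simp add: one delta_one.abs_eq)
  next
    case (3 x y w)
    have "abs_delta (x # y # w) = delta_mult (delta_mult (delta_gen x) (delta_gen y)) (abs_delta w)"
      by (simp add: delta_mult.abs_eq delta_gen.abs_eq)
    with 3 subgroup.m_closed [OF sub pair] show ?case by (simp add: mult)
  qed simp
  show "carrier Delta_plus \<subseteq> ?N"
  proof
    fix g assume g: "g \<in> carrier Delta_plus"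
    obtain w where w: "g = abs_delta w" by (metis Quotient_delta Quotient_abs_rep)
    with g word show "g \<in> ?N" by (simp add: Delta_plus_def even_delta.abs_eq)
  qed
  have "rho \<in> {g. even_delta g}" "lam \<in> {g. even_delta g}"
    by (simp_all add: rho_def lam_def mult even_delta_mult even_delta_gen)
  then show "?N \<subseteq> carrier Delta_plus"
    using generate_subgroup_incl [OF _ subgroup_even] by (simp add: Delta_plus_def)
qed


section \<open>Oriented hypermaps\<close>

definition monodromy_group :: "'d set \<Rightarrow> ('d \<Rightarrow> 'd) \<Rightarrow> ('d \<Rightarrow> 'd) \<Rightarrow> ('d \<Rightarrow> 'd) set" where
  "monodromy_group D R L = generate (BijGroup D) {R, L}"

definition hypermap :: "'d set \<Rightarrow> ('d \<Rightarrow> 'd) \<Rightarrow> ('d \<Rightarrow> 'd) \<Rightarrow> bool" where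
  "hypermap D R L \<longleftrightarrow>
     finite D \<and> D \<noteq> {} \<and> R \<in> Bij D \<and> L \<in> Bij D \<and>
     (\<forall>x\<in>D. \<forall>y\<in>D. \<exists>g\<in>monodromy_group D R L. g x = y)"

definition hypermap_aut :: "'d set \<Rightarrow> ('d \<Rightarrow> 'd) \<Rightarrow> ('d \<Rightarrow> 'd) \<Rightarrow> ('d \<Rightarrow> 'd) set" where
  "hypermap_aut D R L =
     {p \<in> Bij D. compose D p R = compose D R p \<and> compose D p L = compose D L p}"

definition orientably_regular :: "'d set \<Rightarrow> ('d \<Rightarrow> 'd) \<Rightarrow> ('d \<Rightarrow> 'd) \<Rightarrow> bool" where
  "orientably_regular D R L \<longleftrightarrow>
     hypermap D R L \<and> (\<forall>x\<in>D. \<forall>y\<in>D. \<exists>!p. p \<in> hypermap_aut D R L \<and> p x = y)"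

definition hypermap_iso ::
  "'d set \<Rightarrow> ('d \<Rightarrow> 'd) \<Rightarrow> ('d \<Rightarrow> 'd) \<Rightarrow> 'e set \<Rightarrow> ('e \<Rightarrow> 'e) \<Rightarrow> ('e \<Rightarrow> 'e) \<Rightarrow> bool" where
  "hypermap_iso D R L D' R' L' \<longleftrightarrow>
     (\<exists>f. bij_betw f D D' \<and> (\<forall>x\<in>D. f (R x) = R' (f x) \<and> f (L x) = L' (f x)))"

text \<open>
  The darts of \<open>(\<Delta>\<^sup>+/H, \<rho>, \<lambda>)\<close> are cosets of a normal subgroup, so left and right cosets agree; left
  multiplication by \<open>g\<close> sends the coset \<open>C\<close> to \<open>g <# C\<close>.
\<close>

definition coset_darts :: "delta set \<Rightarrow> delta set set" where
  "coset_darts H = carrier (Delta_plus Mod H)"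

definition coset_perm :: "delta set \<Rightarrow> delta \<Rightarrow> delta set \<Rightarrow> delta set" where
  "coset_perm H g = (\<lambda>C\<in>coset_darts H. g <#\<^bsub>Delta_plus\<^esub> C)"

definition hypermap_subgroup ::
  "'d set \<Rightarrow> ('d \<Rightarrow> 'd) \<Rightarrow> ('d \<Rightarrow> 'd) \<Rightarrow> delta set \<Rightarrow> bool" where
  "hypermap_subgroup D R L H \<longleftrightarrow>
     H \<lhd> Delta_plus \<and> finite (rcosets\<^bsub>Delta_plus\<^esub> H) \<and>
     hypermap_iso D R L (coset_darts H) (coset_perm H rho) (coset_perm H lam)"


section \<open>Chirality groups\<close>

definition mirror :: "delta set \<Rightarrow> delta set" where
  "mirror H = {r2 \<otimes>\<^bsub>Delta\<^esub> h \<otimes>\<^bsub>Delta\<^esub> r2 | h. h \<in> H}"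

definition chirality_quotient :: "delta set \<Rightarrow> delta set monoid" where
  "chirality_quotient H = (Delta_plus\<lparr>carrier := H <#>\<^bsub>Delta_plus\<^esub> mirror H\<rparr>) Mod H"

text \<open>
  Taking the darts to be natural numbers loses no generality, because dart sets are finite.
\<close>

definition is_chirality_group :: "('a, 'b) monoid_scheme \<Rightarrow> bool" where
  "is_chirality_group G \<longleftrightarrow>
     (\<exists>(D :: nat set) R L H. orientably_regular D R L \<and> hypermap_subgroup D R L H \<and>
        G \<cong> chirality_quotient H)"


section \<open>Characteristic subgroups and inner automorphisms\<close>

definition characteristic_subgroup :: "'a set \<Rightarrow> ('a, 'b) monoid_scheme \<Rightarrow> bool" where
  "characteristic_subgroup T S \<longleftrightarrow>
     subgroup T S \<and> (\<forall>\<phi>\<in>carrier (AutoGroup S). \<phi> ` T = T)"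

definition center :: "('a, 'b) monoid_scheme \<Rightarrow> 'a set" where
  "center S = {z \<in> carrier S. \<forall>x\<in>carrier S. z \<otimes>\<^bsub>S\<^esub> x = x \<otimes>\<^bsub>S\<^esub> z}"

definition inner_aut :: "('a, 'b) monoid_scheme \<Rightarrow> 'a \<Rightarrow> 'a \<Rightarrow> 'a" where
  "inner_aut S s = (\<lambda>x\<in>carrier S. s \<otimes>\<^bsub>S\<^esub> x \<otimes>\<^bsub>S\<^esub> inv\<^bsub>S\<^esub> s)"

text \<open>
  Conjugation is constant on each coset of the center, so \<open>\<lambda>C. the_elem (inner_aut S ` C)\<close> is the
  embedding of \<open>S/Z\<close> into \<open>Aut(S)\<close>; \<open>bar S T\<close> is the image of \<open>TZ/Z\<close> under it.
\<close>

definition bar :: "('a, 'b) monoid_scheme \<Rightarrow> 'a set \<Rightarrow> ('a \<Rightarrow> 'a) set" where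
  "bar S T =
     (\<lambda>C. the_elem (inner_aut S ` C)) `
       carrier ((S\<lparr>carrier := T <#>\<^bsub>S\<^esub> center S\<rparr>) Mod center S)"

lemma (in group) bar_eq:
  assumes "T \<subseteq> carrier G"
  shows "bar G T = inner_aut G ` T"
proof -
  have conj_eq: "inner_aut G (z \<otimes> a) = inner_aut G a" if z: "z \<in> center G" and a: "a \<in> carrier G" for z a
  proof -
    have "z \<otimes> a \<otimes> x \<otimes> inv (z \<otimes> a) = a \<otimes> x \<otimes> inv a" if x: "x \<in> carrier G" for x
    proof -
      have zc: "z \<in> carrier G" using z by (simp add: center_def)
      have "z \<otimes> a \<otimes> x \<otimes> inv (z \<otimes> a) = z \<otimes> (a \<otimes> x \<otimes> inv a) \<otimes> inv z"
        using zc a x by (simp add: inv_mult_group m_assoc)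
      also have "\<dots> = a \<otimes> x \<otimes> inv a \<otimes> z \<otimes> inv z"
        using z a x by (simp add: center_def)
      also have "\<dots> = a \<otimes> x \<otimes> inv a" using zc a x by (simp add: m_assoc)
      finally show ?thesis .
    qed
    then show ?thesis by (simp add: inner_aut_def cong: restrict_cong)
  qed
  have comm: "a \<otimes> z = z \<otimes> a" if "z \<in> center G" "a \<in> carrier G" for z a
    using that by (simp add: center_def)
  have one: "\<one> \<in> center G" by (simp add: center_def)
  have cls: "the_elem (inner_aut G ` (\<Union>z\<in>center G. {z \<otimes> a})) = inner_aut G a"
    if "a \<in> carrier G" for a
  proof -
    have "inner_aut G ` (\<Union>z\<in>center G. {z \<otimes> a}) = {inner_aut G a}"
      using conj_eq that one by (force simp: image_UN)
    then show ?thesis by simp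
  qed
  have zc: "center G \<subseteq> carrier G" by (auto simp: center_def)
  have "bar G T = (\<lambda>a. the_elem (inner_aut G ` (\<Union>z\<in>center G. {z \<otimes> a}))) ` (T <#> center G)"
    by (auto simp: bar_def FactGroup_def RCOSETS_def r_coset_def image_UN)
  also have "\<dots> = inner_aut G ` (T <#> center G)"
    by (rule image_cong [OF refl cls]) (use set_mult_closed [OF assms zc] in blast)
  also have "\<dots> = inner_aut G ` T"
  proof
    show "inner_aut G ` (T <#> center G) \<subseteq> inner_aut G ` T"
    proof (clarsimp simp: set_mult_def)
      fix t z assume "t \<in> T" "z \<in> center G"
      then show "inner_aut G (t \<otimes> z) \<in> inner_aut G ` T"
        using assms comm conj_eq by (metis imageI subsetD)
    qed
    have "t \<in> T <#> center G" if "t \<in> T" for t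
      using that one assms by (force simp: set_mult_def intro: bexI [of _ t])
    then show "inner_aut G ` T \<subseteq> inner_aut G ` (T <#> center G)" by blast
  qed
  finally show ?thesis .
qed

end

theory Submission
  imports Defs
begin

text \<open>
  Let \<open>S\<close> be isomorphic to the normal subgroup \<open>P = HH\<^sup>r/H\<close> of \<open>Q = \<Delta>\<^sup>+/H\<close>. Conjugation of \<open>P\<close> by \<open>Q\<close>
  gives a homomorphism \<open>f\<close> from \<open>\<Delta>\<^sup>+\<close> to the abelian group \<open>Aut(S)/bar T\<close> that is trivial on \<open>H\<close>.
  Since \<open>r\<^sub>2\<close> inverts both generators \<open>\<rho>\<close> and \<open>\<lambda>\<close> of \<open>\<Delta>\<^sup>+\<close>, it acts on every abelian image of \<open>\<Delta>\<^sup>+\<close> by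
  inversion, so \<open>f\<close> is also trivial on \<open>H\<^sup>r\<close>, hence on \<open>HH\<^sup>r\<close>. But \<open>HH\<^sup>r\<close> induces on \<open>P\<close> all its inner
  automorphisms, which forces \<open>Inn(S) \<subseteq> bar T\<close>.
\<close>

section \<open>Conjugation on a normal subgroup\<close>

lemma (in group) l_inv_cancel: "x \<in> carrier G \<Longrightarrow> y \<in> carrier G \<Longrightarrow> inv x \<otimes> (x \<otimes> y) = y"
  by (simp flip: m_assoc)

text \<open>Conjugation by \<open>q\<close> on a normal subgroup of \<open>Q\<close>, pulled back to
  \<open>S\<close> along an isomorphism \<phi> onto that subgroup. Restriction to the carrier gives
  the extensional functions that \<open>auto S\<close> consists of.\<close>

definition transported_conj ::
  "('a, 'b) monoid_scheme \<Rightarrow> ('c, 'd) monoid_scheme \<Rightarrow> ('a \<Rightarrow> 'c) \<Rightarrow> 'c \<Rightarrow> 'a \<Rightarrow> 'a" where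
  "transported_conj S Q \<phi> q =
     (\<lambda>s\<in>carrier S. inv_into (carrier S) \<phi> (q \<otimes>\<^bsub>Q\<^esub> \<phi> s \<otimes>\<^bsub>Q\<^esub> inv\<^bsub>Q\<^esub> q))"

lemma carrier_AutoGroup: "carrier (AutoGroup S) = auto S"
  by (simp add: AutoGroup_def)

lemma mult_AutoGroup:
  assumes "f \<in> auto S" "g \<in> auto S"
  shows "f \<otimes>\<^bsub>AutoGroup S\<^esub> g = compose (carrier S) f g"
  using assms by (simp add: AutoGroup_def BijGroup_def auto_def)

context
  fixes S :: "('a, 'b) monoid_scheme" and Q :: "('c, 'd) monoid_scheme" and P \<phi>
  assumes S: "group S" and P: "P \<lhd> Q" and \<phi>: "\<phi> \<in> iso S (Q\<lparr>carrier := P\<rparr>)"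
begin

interpretation S: group S by (rule S)
interpretation P: normal P Q by (rule P)

private abbreviation (input) "\<psi> \<equiv> inv_into (carrier S) \<phi>"

private lemma \<phi>_mem: "s \<in> carrier S \<Longrightarrow> \<phi> s \<in> P"
  using \<phi> by (auto simp: iso_def hom_def)

private lemma \<phi>_carrier: "s \<in> carrier S \<Longrightarrow> \<phi> s \<in> carrier Q"
  using \<phi>_mem P.subset by blast

private lemma \<phi>_mult: "s \<in> carrier S \<Longrightarrow> t \<in> carrier S \<Longrightarrow> \<phi> (s \<otimes>\<^bsub>S\<^esub> t) = \<phi> s \<otimes>\<^bsub>Q\<^esub> \<phi> t"
  using \<phi> by (auto simp: iso_def hom_def)

private lemma \<psi>_\<phi>: "s \<in> carrier S \<Longrightarrow> \<psi> (\<phi> s) = s"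
  using \<phi> bij_betw_inv_into_left [of \<phi> "carrier S" P s] by (simp add: iso_def)

private lemma \<phi>_\<psi>: "p \<in> P \<Longrightarrow> \<phi> (\<psi> p) = p"
  using \<phi> bij_betw_inv_into_right [of \<phi> "carrier S" P p] by (simp add: iso_def)

private lemma \<psi>_mem: "p \<in> P \<Longrightarrow> \<psi> p \<in> carrier S"
  using \<phi> bij_betw_inv_into [of \<phi> "carrier S" P] by (auto simp: iso_def dest: bij_betwE)

private lemma \<phi>_inv:
  assumes "s \<in> carrier S"
  shows "\<phi> (inv\<^bsub>S\<^esub> s) = inv\<^bsub>Q\<^esub> \<phi> s"
proof -
  \<comment> \<open>Viewing \<phi> as a map into all of \<open>Q\<close> makes the inverse the one
    taken in \<open>Q\<close>.\<close>
  have "group_hom S Q \<phi>"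
    by (intro group_hom.intro group_hom_axioms.intro S.group_axioms P.group_axioms)
      (auto simp: hom_def \<phi>_carrier \<phi>_mult)
  then show ?thesis using assms by (rule group_hom.hom_inv)
qed

private lemma conj_mem:
  "q \<in> carrier Q \<Longrightarrow> s \<in> carrier S \<Longrightarrow> q \<otimes>\<^bsub>Q\<^esub> \<phi> s \<otimes>\<^bsub>Q\<^esub> inv\<^bsub>Q\<^esub> q \<in> P"
  by (simp add: P.inv_op_closed2 \<phi>_mem)

private lemma transported_conj_mem:
  "q \<in> carrier Q \<Longrightarrow> s \<in> carrier S \<Longrightarrow> transported_conj S Q \<phi> q s \<in> carrier S"
  by (simp add: transported_conj_def \<psi>_mem conj_mem)

private lemma \<phi>_transported_conj:
  "q \<in> carrier Q \<Longrightarrow> s \<in> carrier S \<Longrightarrow>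
   \<phi> (transported_conj S Q \<phi> q s) = q \<otimes>\<^bsub>Q\<^esub> \<phi> s \<otimes>\<^bsub>Q\<^esub> inv\<^bsub>Q\<^esub> q"
  by (simp add: transported_conj_def \<phi>_\<psi> conj_mem)

text \<open>Equations in \<open>S\<close> are checked after applying \<phi>, where transported
  conjugation becomes plain conjugation in \<open>Q\<close>.\<close>

private lemma \<phi>_eqI: "s \<in> carrier S \<Longrightarrow> t \<in> carrier S \<Longrightarrow> \<phi> s = \<phi> t \<Longrightarrow> s = t"
  by (metis \<psi>_\<phi>)

private lemma transported_conj_mult:
  assumes "q \<in> carrier Q" "r \<in> carrier Q"
  shows "transported_conj S Q \<phi> (q \<otimes>\<^bsub>Q\<^esub> r) =
    compose (carrier S) (transported_conj S Q \<phi> q) (transported_conj S Q \<phi> r)"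
proof (rule extensionalityI [of _ "carrier S"])
  fix s assume s: "s \<in> carrier S"
  show "transported_conj S Q \<phi> (q \<otimes>\<^bsub>Q\<^esub> r) s =
      compose (carrier S) (transported_conj S Q \<phi> q) (transported_conj S Q \<phi> r) s"
    using assms s
    by (intro \<phi>_eqI)
      (simp_all add: compose_eq transported_conj_mem \<phi>_transported_conj \<phi>_carrier P.m_assoc
        P.inv_mult_group)
qed (simp_all add: transported_conj_def)

private lemma transported_conj_one: "transported_conj S Q \<phi> \<one>\<^bsub>Q\<^esub> = (\<lambda>s\<in>carrier S. s)"
  by (auto simp: transported_conj_def fun_eq_iff \<phi>_carrier \<psi>_\<phi>)

private lemma transported_conj_auto:
  assumes q: "q \<in> carrier Q"
  shows "transported_conj S Q \<phi> q \<in> auto S"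
proof -
  \<comment> \<open>Bijectivity comes from the action laws for products and the identity:
    \<open>q\<close> and \<open>inv q\<close> act as mutually inverse maps.\<close>
  have inverse: "transported_conj S Q \<phi> q (transported_conj S Q \<phi> r s) = s"
    if "q \<in> carrier Q" "r \<in> carrier Q" "q \<otimes>\<^bsub>Q\<^esub> r = \<one>\<^bsub>Q\<^esub>" "s \<in> carrier S" for q r s
    using transported_conj_mult [of q r] that transported_conj_one
    by (metis compose_eq restrict_apply')
  have "bij_betw (transported_conj S Q \<phi> q) (carrier S) (carrier S)"
    by (rule bij_betw_byWitness [where f' = "transported_conj S Q \<phi> (inv\<^bsub>Q\<^esub> q)"])
      (use q in \<open>auto simp: inverse transported_conj_mem\<close>)
  moreover have "transported_conj S Q \<phi> q (s \<otimes>\<^bsub>S\<^esub> t) =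
      transported_conj S Q \<phi> q s \<otimes>\<^bsub>S\<^esub> transported_conj S Q \<phi> q t"
    if "s \<in> carrier S" "t \<in> carrier S" for s t
    using q that
    by (intro \<phi>_eqI)
      (simp_all add: transported_conj_mem \<phi>_transported_conj \<phi>_mult \<phi>_carrier P.m_assoc
        P.l_inv_cancel)
  ultimately show ?thesis
    using q by (auto simp: auto_def Bij_def hom_def transported_conj_mem)
      (simp add: transported_conj_def)
qed

lemma transported_conj_hom: "transported_conj S Q \<phi> \<in> hom Q (AutoGroup S)"
  by (auto simp: hom_def carrier_AutoGroup transported_conj_auto transported_conj_mult
      mult_AutoGroup)

text \<open>Conjugation by \<phi> \<open>s\<close> stays inside the image of \<phi>, so the
  homomorphism \<phi> matches it with conjugation by \<open>s\<close>. Through this the normal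
  subgroup realizes every inner automorphism of \<open>S\<close>.\<close>

lemma transported_conj_image:
  assumes "s \<in> carrier S"
  shows "transported_conj S Q \<phi> (\<phi> s) = inner_aut S s"
proof (rule extensionalityI [of _ "carrier S"])
  fix t assume "t \<in> carrier S"
  with assms show "transported_conj S Q \<phi> (\<phi> s) t = inner_aut S s t"
    by (intro \<phi>_eqI)
      (simp_all add: inner_aut_def transported_conj_mem \<phi>_transported_conj \<phi>_carrier \<phi>_mult \<phi>_inv)
qed (simp_all add: transported_conj_def inner_aut_def)

end

section \<open>Inner automorphisms inside the automorphism group\<close>

lemma (in group) inner_aut_hom: "inner_aut G \<in> hom G (AutoGroup G)"
proof -
  \<comment> \<open>The group acts on itself as a normal subgroup, with the identity as isomorphism;
    this transported conjugation agrees with \<open>inner_aut G\<close> on the carrier.\<close>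
  have "carrier G \<lhd> G" by (rule normal_invI [OF subgroup_self]) simp
  then have "transported_conj G G (\<lambda>x. x) \<in> hom G (AutoGroup G)"
    and "\<And>s. s \<in> carrier G \<Longrightarrow> transported_conj G G (\<lambda>x. x) s = inner_aut G s"
    using transported_conj_hom [of G "carrier G" G "\<lambda>x. x"]
      transported_conj_image [of G "carrier G" G "\<lambda>x. x"] by (simp_all add: iso_set_refl is_group)
  then show ?thesis by (rule hom_restrict)
qed

lemma (in group) inner_aut_conj:
  assumes \<alpha>: "\<alpha> \<in> carrier (AutoGroup G)" and t: "t \<in> carrier G"
  shows "\<alpha> \<otimes>\<^bsub>AutoGroup G\<^esub> inner_aut G t \<otimes>\<^bsub>AutoGroup G\<^esub> inv\<^bsub>AutoGroup G\<^esub> \<alpha> = inner_aut G (\<alpha> t)"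
proof -
  interpret A: group "AutoGroup G" by (rule AutoGroup)
  have \<alpha>': "\<alpha> \<in> auto G" using \<alpha> by (simp add: carrier_AutoGroup)
  have mem: "\<alpha> x \<in> carrier G" if "x \<in> carrier G" for x
    using \<alpha>' that by (auto simp: auto_def hom_def)
  interpret \<alpha>: group_hom G G \<alpha>
    using \<alpha>' by (unfold_locales) (simp add: auto_def)
  have inn: "inner_aut G x \<in> carrier (AutoGroup G)" if "x \<in> carrier G" for x
    using inner_aut_hom that by (rule hom_in_carrier)
  \<comment> \<open>Moving \<alpha> to the right-hand side avoids computing its inverse: both sides
    send \<open>x\<close> to the conjugate of \<alpha> \<open>x\<close> by \<alpha>
    \<open>t\<close>.\<close>
  have "\<alpha> \<otimes>\<^bsub>AutoGroup G\<^esub> inner_aut G t = inner_aut G (\<alpha> t) \<otimes>\<^bsub>AutoGroup G\<^esub> \<alpha>"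
    using \<alpha>' inn [OF t] inn [OF mem [OF t]] t
    by (auto simp: mult_AutoGroup carrier_AutoGroup compose_def inner_aut_def fun_eq_iff)
  with \<alpha> inn t mem show ?thesis by (simp add: A.m_assoc)
qed

text \<open>By \<open>inner_aut_conj\<close>, conjugation by \<alpha> moves the inner automorphism
  of \<open>t\<close> to that of \<alpha> \<open>t\<close>, which is again in \<open>T\<close>
  because \<open>T\<close> is characteristic.\<close>

lemma (in group) bar_normal:
  assumes "characteristic_subgroup T G"
  shows "bar G T \<lhd> AutoGroup G"
proof -
  interpret A: group "AutoGroup G" by (rule AutoGroup)
  have T: "subgroup T G" and char: "\<And>\<alpha>. \<alpha> \<in> carrier (AutoGroup G) \<Longrightarrow> \<alpha> ` T = T"
    using assms by (auto simp: characteristic_subgroup_def)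
  have eq: "bar G T = inner_aut G ` T" using bar_eq [OF subgroup.subset [OF T]] .
  interpret inn: group_hom G "AutoGroup G" "inner_aut G"
    by unfold_locales (rule inner_aut_hom)
  show ?thesis
    unfolding eq
  proof (rule A.normal_invI)
    show "subgroup (inner_aut G ` T) (AutoGroup G)" by (rule inn.subgroup_img_is_subgroup [OF T])
    fix \<alpha> h assume \<alpha>: "\<alpha> \<in> carrier (AutoGroup G)" and "h \<in> inner_aut G ` T"
    then obtain t where t: "t \<in> T" "h = inner_aut G t" by blast
    with \<alpha> char [OF \<alpha>] subgroup.mem_carrier [OF T]
    show "\<alpha> \<otimes>\<^bsub>AutoGroup G\<^esub> h \<otimes>\<^bsub>AutoGroup G\<^esub> inv\<^bsub>AutoGroup G\<^esub> \<alpha> \<in> inner_aut G ` T"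
      by (auto simp: inner_aut_conj)
  qed
qed


section \<open>The mirror automorphism\<close>

interpretation Delta: group Delta by (rule group_Delta)
interpretation Delta_plus: group Delta_plus by (rule group_Delta_plus)

lemma Delta_carrier [simp]: "g \<in> carrier Delta"
  by (simp add: Delta_def)

lemma Delta_plus_carrier: "carrier Delta_plus = {g. even_delta g}"
  by (simp add: Delta_plus_def)

lemma Delta_plus_mult [simp]: "monoid.mult Delta_plus = monoid.mult Delta"
  by (simp add: Delta_plus_def)

lemma Delta_plus_inv: "g \<in> carrier Delta_plus \<Longrightarrow> inv\<^bsub>Delta_plus\<^esub> g = inv\<^bsub>Delta\<^esub> g"
  unfolding Delta_plus_def by (rule Delta.m_inv_consistent [OF subgroup_even]) simp

lemma gen_square: "delta_gen x \<otimes>\<^bsub>Delta\<^esub> delta_gen x = \<one>\<^bsub>Delta\<^esub>"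
  by (simp add: Delta_def delta_gen_square)

lemma gen_square_assoc: "delta_gen x \<otimes>\<^bsub>Delta\<^esub> (delta_gen x \<otimes>\<^bsub>Delta\<^esub> g) = g"
  by (simp add: gen_square flip: Delta.m_assoc)

lemma gen_inv: "inv\<^bsub>Delta\<^esub> delta_gen x = delta_gen x"
  by (rule Delta.inv_equality) (simp_all add: gen_square)

definition mirror_map :: "delta \<Rightarrow> delta" where
  "mirror_map g = r2 \<otimes>\<^bsub>Delta\<^esub> g \<otimes>\<^bsub>Delta\<^esub> r2"

lemma mirror_eq_image: "mirror H = mirror_map ` H"
  by (auto simp: mirror_def mirror_map_def)

lemma mirror_map_mult: "mirror_map (g \<otimes>\<^bsub>Delta\<^esub> h) = mirror_map g \<otimes>\<^bsub>Delta\<^esub> mirror_map h"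
  by (simp add: mirror_map_def Delta.m_assoc gen_square_assoc)

lemma mirror_map_idem: "mirror_map (mirror_map g) = g"
  by (simp add: mirror_map_def Delta.m_assoc gen_square_assoc gen_square)

lemma mirror_map_even: "mirror_map g \<in> carrier Delta_plus \<longleftrightarrow> g \<in> carrier Delta_plus"
  by (simp add: Delta_plus_carrier mirror_map_def Delta_def even_delta_mult even_delta_gen)

text \<open>Although \<open>r2\<close> is odd, conjugation by it preserves parity and is its own
  inverse. This is what makes \<open>mirror H\<close> normal whenever \<open>H\<close> is.\<close>

lemma mirror_map_iso: "mirror_map \<in> iso Delta_plus Delta_plus"
proof -
  have "bij_betw mirror_map (carrier Delta_plus) (carrier Delta_plus)"
    by (rule bij_betw_byWitness [where f' = mirror_map])
      (auto simp: mirror_map_idem mirror_map_even)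
  then show ?thesis by (simp add: iso_def hom_def mirror_map_mult mirror_map_even)
qed

text \<open>Cancelling \<open>r2 r2\<close> leaves \<open>r2 r1\<close> from \<open>rho\<close> and
  \<open>r0 r2\<close> from \<open>lam\<close>; these are the inverses because the three letters are
  involutions.\<close>

lemma mirror_map_generator:
  assumes "g \<in> {rho, lam}"
  shows "mirror_map g = inv\<^bsub>Delta\<^esub> g"
  using assms
  by (auto simp: mirror_map_def rho_def lam_def Delta.inv_mult_group gen_inv Delta.m_assoc
      gen_square gen_square_assoc)

text \<open>As \<open>B\<close> is abelian, inversion on \<open>B\<close> is a homomorphism, so both
  sides are homomorphisms in \<open>g\<close>; they agree on the generators.\<close>

lemma abelian_image_mirror_map:
  assumes B: "comm_group B" and f: "f \<in> hom Delta_plus B" and g: "g \<in> carrier Delta_plus"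
  shows "f (mirror_map g) = inv\<^bsub>B\<^esub> f g"
proof -
  interpret B: comm_group B by (rule B)
  interpret f: group_hom Delta_plus B f by unfold_locales (rule f)
  \<comment> \<open>The induction runs over generation in \<open>Delta\<close>, so its inverses are
    those of \<open>Delta\<close>; \<open>Delta_plus_inv\<close> matches them with those of
    \<open>Delta_plus\<close>.\<close>
  have gen_carrier: "generate Delta {rho, lam} = carrier Delta_plus"
    using Delta_plus_generated by simp
  have generator: "h \<in> carrier Delta_plus" "f (mirror_map h) = inv\<^bsub>B\<^esub> f h" if "h \<in> {rho, lam}" for h
  proof -
    show h: "h \<in> carrier Delta_plus" using generate.incl [OF that] gen_carrier by blast
    then show "f (mirror_map h) = inv\<^bsub>B\<^esub> f h"
      using mirror_map_generator [OF that] f.hom_inv [OF h] by (simp add: Delta_plus_inv)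
  qed
  have "g \<in> generate Delta {rho, lam}" using g gen_carrier by simp
  then show ?thesis
  proof induction
    case one
    have "mirror_map \<one>\<^bsub>Delta\<^esub> = \<one>\<^bsub>Delta\<^esub>"
      by (simp add: mirror_map_def gen_square)
    moreover have "f \<one>\<^bsub>Delta\<^esub> = \<one>\<^bsub>B\<^esub>"
      using f.hom_one by (simp add: Delta_plus_def)
    ultimately show ?case by (simp only: B.inv_one)
  next
    case (incl h)
    then show ?case by (rule generator)
  next
    case (inv h)
    \<comment> \<open>The inverse of a generator is its mirror image, and mirroring twice is the
      identity.\<close>
    have "f (mirror_map (inv\<^bsub>Delta\<^esub> h)) = f h"
      by (simp only: mirror_map_generator [OF inv, symmetric] mirror_map_idem)
    also have "\<dots> = inv\<^bsub>B\<^esub> f (mirror_map h)"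
      using generator [OF inv] by (simp only: f.hom_closed B.inv_inv)
    finally show ?case by (simp only: mirror_map_generator [OF inv])
  next
    case (eng h k)
    then have "h \<in> carrier Delta_plus" "k \<in> carrier Delta_plus"
      using gen_carrier by auto
    \<comment> \<open>Commutativity of \<open>B\<close> enters here, through
      \<open>B.inv_mult\<close>: inversion preserves the order of the factors.\<close>
    with eng.IH f.hom_mult [of h k] f.hom_mult [of "mirror_map h" "mirror_map k"] show ?case
      by (simp add: mirror_map_mult mirror_map_even B.inv_mult)
  qed
qed


section \<open>The chirality group as a normal subgroup\<close>

text \<open>A conjugate of a product is the product of the conjugates, each of which stays in its
  own normal factor.\<close>

lemma (in group) set_mult_normal:
  assumes N: "N \<lhd> G" and K: "K \<lhd> G"
  shows "N <#> K \<lhd> G"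
proof (rule normal_invI)
  show "subgroup (N <#> K) G" by (rule mult_norm_subgroup [OF N normal_imp_subgroup [OF K]])
  fix x h assume x: "x \<in> carrier G" and "h \<in> N <#> K"
  then obtain n k where nk: "n \<in> N" "k \<in> K" "h = n \<otimes> k" by (auto simp: set_mult_def)
  then have car: "n \<in> carrier G" "k \<in> carrier G"
    by (simp_all add: subgroup.mem_carrier [OF normal_imp_subgroup [OF N]]
        subgroup.mem_carrier [OF normal_imp_subgroup [OF K]])
  have "x \<otimes> h \<otimes> inv x = (x \<otimes> n \<otimes> inv x) \<otimes> (x \<otimes> k \<otimes> inv x)"
    using x car nk by (simp add: m_assoc l_inv_cancel)
  then show "x \<otimes> h \<otimes> inv x \<in> N <#> K"
    using normal.inv_op_closed2 [OF N x] normal.inv_op_closed2 [OF K x] nk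
    unfolding set_mult_def by blast
qed

lemma mirror_product_normal:
  assumes "H \<lhd> Delta_plus"
  shows "H <#>\<^bsub>Delta_plus\<^esub> mirror H \<lhd> Delta_plus"
  unfolding mirror_eq_image
  by (intro Delta_plus.set_mult_normal assms iso_normal_subgroup [OF mirror_map_iso]
      group_Delta_plus)

text \<open>Cosets of \<open>H\<close> depend only on the multiplication, which shrinking the
  carrier leaves unchanged. So the chirality quotient can be read as a subgroup of
  \<open>Delta_plus Mod H\<close>, on which the whole quotient acts.\<close>

lemma FactGroup_subgroup_eq:
  "(G\<lparr>carrier := M\<rparr>) Mod H = (G Mod H)\<lparr>carrier := (\<lambda>x. H #>\<^bsub>G\<^esub> x) ` M\<rparr>"
  by (auto simp: FactGroup_def RCOSETS_def fun_eq_iff)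

section \<open>Triviality of the conjugation action modulo \<open>bar S T\<close>\<close>

theorem theorem21:
  fixes S :: "('a, 'b) monoid_scheme" and T :: "'a set"
  assumes "group S"
    and "characteristic_subgroup T S"
    and "bar S T \<subset> bar S (carrier S)"
    and "comm_group (AutoGroup S Mod bar S T)"
  shows "\<not> is_chirality_group S"
proof
  assume "is_chirality_group S"
  then obtain H where H: "H \<lhd> Delta_plus" and iso: "S \<cong> chirality_quotient H"
    unfolding is_chirality_group_def hypermap_subgroup_def by blast
  let ?A = "AutoGroup S" and ?B = "AutoGroup S Mod bar S T" and ?Q = "Delta_plus Mod H"
  interpret S: group S by fact
  interpret H: normal H Delta_plus by (rule H)
  interpret T: normal "bar S T" ?A by (rule S.bar_normal) fact
  interpret B: comm_group ?B by fact
  interpret Q: group ?Q by (rule H.factorgroup_is_group)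
  \<comment> \<open>With \<pi> the projection modulo \<open>H\<close>, the image of \<open>M\<close>
    is the chirality group inside \<open>?Q\<close>.\<close>
  define M where "M = H <#>\<^bsub>Delta_plus\<^esub> mirror H"
  define \<pi> where "\<pi> = (\<lambda>x. H #>\<^bsub>Delta_plus\<^esub> x)"
  have M: "M \<lhd> Delta_plus" unfolding M_def by (rule mirror_product_normal [OF H])
  have \<pi>: "\<pi> \<in> hom Delta_plus ?Q" unfolding \<pi>_def by (rule H.r_coset_hom_Mod)
  have P: "\<pi> ` M \<lhd> ?Q"
  proof (rule normal.surj_hom_normal_subgroup [OF M])
    show "group_hom Delta_plus ?Q \<pi>" by unfold_locales (rule \<pi>)
    show "\<pi> ` carrier Delta_plus = carrier ?Q" by (simp add: carrier_FactGroup \<pi>_def)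
  qed
  obtain \<phi> where \<phi>: "\<phi> \<in> Group.iso S (?Q\<lparr>carrier := \<pi> ` M\<rparr>)"
    using iso unfolding is_iso_def chirality_quotient_def FactGroup_subgroup_eq M_def \<pi>_def by blast
  define c where "c = transported_conj S ?Q \<phi>"
  \<comment> \<open>The composite goes from \<open>Delta_plus\<close> through \<open>?Q\<close> and
    \<open>?A\<close> to the abelian group \<open>?B\<close>.\<close>
  define f where "f = (\<lambda>\<alpha>. bar S T #>\<^bsub>?A\<^esub> \<alpha>) \<circ> c \<circ> \<pi>"
  have "c \<in> hom ?Q ?A" unfolding c_def by (rule transported_conj_hom [OF \<open>group S\<close> P \<phi>])
  then have f: "f \<in> hom Delta_plus ?B"
    unfolding f_def using \<pi> T.r_coset_hom_Mod by (intro hom_compose)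
  interpret f: group_hom Delta_plus ?B f by unfold_locales (rule f)
  have f_H: "f h = \<one>\<^bsub>?B\<^esub>" if "h \<in> H" for h
  proof -
    have "\<pi> h = \<pi> \<one>\<^bsub>Delta_plus\<^esub>"
      unfolding \<pi>_def
      by (simp only: H.rcos_const [OF group_Delta_plus] that H.one_closed)
    then have "f h = f \<one>\<^bsub>Delta_plus\<^esub>" by (simp add: f_def)
    then show ?thesis by simp
  qed
  have f_M: "f m = \<one>\<^bsub>?B\<^esub>" if m: "m \<in> M" for m
  proof -
    obtain h k where hk: "h \<in> H" "k \<in> H" "m = h \<otimes>\<^bsub>Delta_plus\<^esub> mirror_map k"
      using m by (auto simp: M_def set_mult_def mirror_eq_image)
    \<comment> \<open>In an abelian image the mirror of \<open>k\<close> maps to the inverse of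
      \<open>f k\<close>, which is trivial since \<open>k\<close> is in \<open>H\<close>.\<close>
    then have "f (mirror_map k) = \<one>\<^bsub>?B\<^esub>"
      using abelian_image_mirror_map [OF B.comm_group_axioms f, of k] f_H
      by (simp only: H.mem_carrier B.inv_one)
    with hk f.hom_mult [of h "mirror_map k"] show ?thesis
      by (simp add: f_H mirror_map_even del: one_FactGroup mult_FactGroup)
  qed
  have "inner_aut S s \<in> bar S T" if s: "s \<in> carrier S" for s
  proof -
    have "\<phi> s \<in> \<pi> ` M" using \<phi> s by (auto simp: iso_def hom_def)
    then obtain m where m: "m \<in> M" "\<phi> s = \<pi> m" by blast
    \<comment> \<open>The inner automorphism of \<open>s\<close> is thus the action of some
      \<open>m\<close> in \<open>M\<close>; as \<open>f m\<close> is trivial, its coset is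
      \<open>bar S T\<close> itself.\<close>
    have "c (\<pi> m) = inner_aut S s"
      unfolding c_def using transported_conj_image [OF \<open>group S\<close> P \<phi> s] m by simp
    with f_M [OF m(1)] have "bar S T #>\<^bsub>?A\<^esub> inner_aut S s = bar S T" by (simp add: f_def)
    then show ?thesis
      using T.coset_join1 T.subset hom_in_carrier [OF S.inner_aut_hom s] T.subgroup_axioms by blast
  qed
  \<comment> \<open>All of Inn(S) lies in \<open>bar S T\<close>, against the strict inclusion
    assumed.\<close>
  then have "bar S (carrier S) \<subseteq> bar S T" using S.bar_eq [of "carrier S"] by auto
  with assms(3) show False by blast
qed

end
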